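(* Let $p\in\mathbb{R}$. The inequality $I(a,b)<Z_p(a,b)$ holds for all $a,b>0$ with $a\neq b$ if and only if $p\ge \frac13$.
   Context: For $a,b>0$ with $a\ne b$ the identric (exponential) mean is $I(a,b)=e^{-1}\left(\dfrac{a^a}{b^b}\right)^{1/(a-b)}$, with $I(a,a)=a$. For $a,b>0$ the power-exponential mean is $Z(a,b)=a^{\frac{a}{a+b}}b^{\frac{b}{a+b}}$. For $p\in\mathbb{R}$, $Z_p(a,b)=\left(Z(a^p,b^p)\right)^{1/p}$ if $p\neq0$ and $Z_0(a,b)=\sqrt{ab}$. *)

theory Defs
  imports Complex_Main
begin

text \<open>All means below are meant for positive arguments only; their values elsewhere are junk.\<close>

definition identric_mean :: "real \<Rightarrow> real \<Rightarrow> real" where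
  "identric_mean a b =
     (if a = b then a
      else exp (-1) * ((a powr a) / (b powr b)) powr (1 / (a - b)))"

definition power_exp_mean :: "real \<Rightarrow> real \<Rightarrow> real" where
  "power_exp_mean a b = a powr (a / (a + b)) * b powr (b / (a + b))"

definition power_exp_mean_ord :: "real \<Rightarrow> real \<Rightarrow> real \<Rightarrow> real" where
  "power_exp_mean_ord p a b =
     (if p = 0 then sqrt (a * b)
      else (power_exp_mean (a powr p) (b powr p)) powr (1 / p))"

end

theory Submission
  imports Defs "HOL-Real_Asymp.Real_Asymp"
begin

text \<open>
  Both means are homogeneous of degree one, so only the ratio of the arguments matters. Writing
  \<open>a = g e\<^sup>t\<close> and \<open>b = g e\<^sup>-\<^sup>t\<close>, where \<open>g\<close> is the geometric mean, one finds
  \<open>ln (I / g) = t coth t - 1\<close> and \<open>ln (Z\<^sub>p / g) = t tanh (p t)\<close>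
  (lemmas \<open>identric_mean_exp\<close> and \<open>power_exp_mean_ord_exp\<close>), the latter also for \<open>p = 0\<close>.
  The claim is therefore that \<open>t coth t - 1 < t tanh (p t)\<close> holds for all \<open>t \<noteq> 0\<close> if and only
  if \<open>p \<ge> 1/3\<close>.

  As \<open>t \<rightarrow> 0\<close> the two sides are \<open>t\<^sup>2/3 + o(t\<^sup>2)\<close> and \<open>p t\<^sup>2 + o(t\<^sup>2)\<close>; dividing by \<open>t\<^sup>2\<close> and
  passing to the limit shows that \<open>p \<ge> 1/3\<close> is necessary.
  Conversely, the right-hand side increases with \<open>p\<close>, so \<open>p = 1/3\<close> suffices. There the addition
  formulas, applied with \<open>u = 2t/3\<close>, turn the inequality into \<open>3 u < 2 sinh u + tanh u\<close>
  (a hyperbolic counterpart of Huygens' inequality). Both sides vanish at \<open>0\<close>, and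
  the derivatives compare because \<open>c + c + 1/c\<^sup>2 > 3\<close> for \<open>c = cosh u > 1\<close>, by the inequality
  between the arithmetic and the geometric mean.
\<close>

lemma identric_mean_exp:
  fixes g t :: real
  assumes "g > 0" and "t \<noteq> 0"
  shows "identric_mean (g * exp t) (g * exp (-t)) = g * exp (t * cosh t / sinh t - 1)"
proof -
  define a b where "a = g * exp t" and "b = g * exp (-t)"
  have pos: "a > 0" "b > 0" and ne: "a \<noteq> b"
    using assms by (auto simp: a_def b_def)
  have ln: "ln a = ln g + t" "ln b = ln g - t"
    using assms by (auto simp: a_def b_def ln_mult)
  have sum: "a + b = 2 * g * cosh t" and diff: "a - b = 2 * g * sinh t"
    by (auto simp: a_def b_def cosh_field_def sinh_field_def algebra_simps)
  have "identric_mean a b = exp (-1) * exp ((a * ln a - b * ln b) / (a - b))"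
    using pos ne by (simp add: identric_mean_def powr_def exp_diff [symmetric])
  also have "a * ln a - b * ln b = (a - b) * ln g + (a + b) * t"
    by (simp add: ln algebra_simps)
  also have "\<dots> / (a - b) = ln g + t * cosh t / sinh t"
    using assms ne by (simp add: sum diff field_simps)
  also have "exp (-1) * exp \<dots> = g * exp (t * cosh t / sinh t - 1)"
    using assms by (simp add: exp_add exp_diff exp_minus divide_inverse)
  finally show ?thesis
    by (simp add: a_def b_def)
qed

lemma power_exp_mean_exp:
  fixes g s :: real
  assumes "g > 0"
  shows "power_exp_mean (g * exp s) (g * exp (-s)) = g * exp (s * tanh s)"
proof -
  define a b where "a = g * exp s" and "b = g * exp (-s)"
  have pos: "a > 0" "b > 0"
    using assms by (auto simp: a_def b_def)
  have ln: "ln a = ln g + s" "ln b = ln g - s"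
    using assms by (auto simp: a_def b_def ln_mult)
  have sum: "a + b = 2 * g * cosh s" and diff: "a - b = 2 * g * sinh s"
    by (auto simp: a_def b_def cosh_field_def sinh_field_def algebra_simps)
  have "power_exp_mean a b = exp ((a * ln a + b * ln b) / (a + b))"
    using pos by (simp add: power_exp_mean_def powr_def exp_add [symmetric] add_divide_distrib)
  also have "a * ln a + b * ln b = (a + b) * ln g + (a - b) * s"
    by (simp add: ln algebra_simps)
  also have "\<dots> / (a + b) = ln g + s * tanh s"
    using assms pos by (simp add: sum diff tanh_def field_simps)
  also have "exp \<dots> = g * exp (s * tanh s)"
    using assms by (simp add: exp_add)
  finally show ?thesis
    by (simp add: a_def b_def)
qed

lemma power_exp_mean_ord_exp:
  fixes g t p :: real
  assumes "g > 0"
  shows "power_exp_mean_ord p (g * exp t) (g * exp (-t)) = g * exp (t * tanh (p * t))"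
proof (cases "p = 0")
  case True
  have "(g * exp t) * (g * exp (-t)) = g\<^sup>2"
    by (simp add: exp_minus power2_eq_square field_simps)
  then show ?thesis
    using True assms by (simp add: power_exp_mean_ord_def)
next
  case False
  have "(g * exp t) powr p = g powr p * exp (p * t)"
    and "(g * exp (-t)) powr p = g powr p * exp (- (p * t))"
    using assms by (simp_all add: powr_mult exp_powr_real mult.commute)
  then have "power_exp_mean_ord p (g * exp t) (g * exp (-t))
      = (g powr p * exp (p * t * tanh (p * t))) powr (1 / p)"
    using False assms by (simp add: power_exp_mean_ord_def power_exp_mean_exp)
  also have "\<dots> = g * exp (t * tanh (p * t))"
    using False assms by (simp add: powr_mult powr_powr exp_powr_real)
  finally show ?thesis .
qed

lemma exp_coordinates:
  fixes a b :: real
  assumes "a > 0" "b > 0" "a \<noteq> b"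
  obtains g t where "g > 0" "t \<noteq> 0" "a = g * exp t" "b = g * exp (-t)"
proof
  show "exp ((ln a + ln b) / 2) > 0"
    by simp
  show "(ln a - ln b) / 2 \<noteq> 0"
    using assms by simp
  show "a = exp ((ln a + ln b) / 2) * exp ((ln a - ln b) / 2)"
    and "b = exp ((ln a + ln b) / 2) * exp (- ((ln a - ln b) / 2))"
    using assms by (simp_all add: exp_add [symmetric] field_simps)
qed

text \<open>The derivative of the difference of the two sides is \<open>2c + 1/c\<^sup>2 - 3\<close> with \<open>c = cosh u\<close>, and
  this equals \<open>(c - 1)\<^sup>2 (2c + 1) / c\<^sup>2\<close>.\<close>

lemma hyperbolic_Huygens:
  fixes u :: real
  assumes "u > 0"
  shows "3 * u < 2 * sinh u + tanh u"
proof -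
  define h where "h = (\<lambda>x :: real. 2 * sinh x + tanh x - 3 * x)"
  have "h 0 < h u"
  proof (rule DERIV_pos_imp_increasing_open [OF assms])
    fix x :: real
    assume "0 < x" "x < u"
    define c where "c = cosh x"
    have c: "c > 1"
      using cosh_real_strict_mono [of 0 x] \<open>0 < x\<close> by (simp add: c_def)
    have "(h has_real_derivative 2 * c + (1 - (tanh x)\<^sup>2) - 3) (at x)"
      unfolding h_def c_def by (auto intro!: derivative_eq_intros)
    moreover have "1 - (tanh x)\<^sup>2 = 1 / c\<^sup>2"
      using c by (simp add: tanh_def c_def power_divide sinh_square_eq diff_divide_distrib)
    moreover have "2 * c + 1 / c\<^sup>2 - 3 = (c - 1)\<^sup>2 * (2 * c + 1) / c\<^sup>2"
      using c by (simp add: field_simps power2_eq_square)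
    moreover have "\<dots> > 0"
      using c by simp
    ultimately show "\<exists>y. DERIV h x :> y \<and> y > 0"
      by auto
  next
    show "continuous_on {0..u} h"
      unfolding h_def by (auto intro!: continuous_intros)
  qed
  then show ?thesis
    by (simp add: h_def)
qed

text \<open>The reduction to the previous lemma rests on
  \<open>coth (3s) - tanh s = cosh (2s) / (sinh (3s) cosh s)\<close> and
  \<open>2 sinh (3s) cosh s = sinh (4s) + sinh (2s) = sinh (2s) (2 cosh (2s) + 1)\<close>, with \<open>s = t/3\<close>.\<close>

lemma coth_less_tanh_third:
  fixes t :: real
  assumes "t > 0"
  shows "t * cosh t / sinh t - 1 < t * tanh (t / 3)"
proof -
  define s where "s = t / 3"
  have t: "t = 2 * s + s" and s: "s > 0"
    using assms by (auto simp: s_def)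
  have pos: "cosh s > 0" "cosh (2 * s) > 0" "sinh t > 0"
    using assms by auto
  have num: "cosh t * cosh s - sinh t * sinh s = cosh (2 * s)"
    using cosh_diff [of t s] by (simp add: t)
  have "2 * (sinh t * cosh s) = sinh (t + s) + sinh (t - s)"
    by (simp add: sinh_add sinh_diff)
  also have "\<dots> = sinh (2 * (2 * s)) + sinh (2 * s)"
    by (simp add: t)
  also have "\<dots> = sinh (2 * s) * (2 * cosh (2 * s) + 1)"
    by (simp only: sinh_double) (simp add: algebra_simps)
  finally have den: "2 * (sinh t * cosh s) = sinh (2 * s) * (2 * cosh (2 * s) + 1)" .
  have "3 * (2 * s) * cosh (2 * s) < (2 * sinh (2 * s) + tanh (2 * s)) * cosh (2 * s)"
    using hyperbolic_Huygens [of "2 * s"] s pos(2) by (intro mult_strict_right_mono) auto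
  also have "\<dots> = 2 * (sinh t * cosh s)"
    unfolding den using pos(2) by (simp add: tanh_def field_simps)
  finally have "t * (cosh t * cosh s - sinh t * sinh s) < sinh t * cosh s"
    unfolding num by (simp add: t algebra_simps)
  then have "t * cosh t / sinh t - 1 < t * tanh s"
    using pos by (simp add: tanh_def field_simps)
  then show ?thesis
    by (simp add: s_def)
qed

lemma coth_less_tanh:
  fixes p t :: real
  assumes "p \<ge> 1 / 3" and "t \<noteq> 0"
  shows "t * cosh t / sinh t - 1 < t * tanh (p * t)"
proof -
  have main: "x * cosh x / sinh x - 1 < x * tanh (p * x)" if "x > 0" for x
  proof -
    have "x / 3 \<le> p * x"
      using mult_right_mono [OF assms(1), of x] that by simp
    then have "x * tanh (x / 3) \<le> x * tanh (p * x)"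
      using that by (intro mult_left_mono) auto
    with coth_less_tanh_third [OF that] show ?thesis
      by simp
  qed
  \<comment> \<open>Both sides are even functions of \<open>t\<close>.\<close>
  show ?thesis
    using main [of t] main [of "-t"] assms(2) by (cases "t > 0") auto
qed

text \<open>The expansion \<open>t coth t = 1 + t\<^sup>2/3 + o(t\<^sup>2)\<close> is where the critical value \<open>1/3\<close> comes from.\<close>

lemma coth_less_tanh_imp_ge_third:
  fixes p :: real
  assumes "\<And>t. t > 0 \<Longrightarrow> t * cosh t / sinh t - 1 < t * tanh (p * t)"
  shows "p \<ge> 1 / 3"
proof (rule tendsto_le)
  show "((\<lambda>t :: real. (t * cosh t / sinh t - 1) / t\<^sup>2) \<longlongrightarrow> 1 / 3) (at_right 0)"
    unfolding cosh_field_def sinh_field_def by real_asymp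
  have "((\<lambda>t. tanh (p * t)) has_real_derivative p) (at 0)"
    by (auto intro!: derivative_eq_intros)
  then show "((\<lambda>t. tanh (p * t) / t) \<longlongrightarrow> p) (at_right 0)"
    by (auto simp: DERIV_def intro: tendsto_within_subset)
  show "\<forall>\<^sub>F t in at_right 0. (t * cosh t / sinh t - 1) / t\<^sup>2 \<le> tanh (p * t) / t"
    using eventually_at_right_less [of "0 :: real"]
  proof eventually_elim
    case (elim t)
    with assms [of t] have "(t * cosh t / sinh t - 1) / t\<^sup>2 \<le> t * tanh (p * t) / t\<^sup>2"
      by (intro divide_right_mono) auto
    then show ?case
      using elim by (simp add: power2_eq_square)
  qed
qed simp

theorem theorem6:
  fixes p :: real
  shows "(\<forall>a b :: real. a > 0 \<longrightarrow> b > 0 \<longrightarrow> a \<noteq> b \<longrightarrow>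
            identric_mean a b < power_exp_mean_ord p a b)
         \<longleftrightarrow> p \<ge> 1 / 3"
proof
  assume less: "\<forall>a b :: real. a > 0 \<longrightarrow> b > 0 \<longrightarrow> a \<noteq> b \<longrightarrow>
    identric_mean a b < power_exp_mean_ord p a b"
  show "p \<ge> 1 / 3"
  proof (rule coth_less_tanh_imp_ge_third)
    fix t :: real
    assume "t > 0"
    then have "identric_mean (exp t) (exp (-t)) < power_exp_mean_ord p (exp t) (exp (-t))"
      using less by simp
    then show "t * cosh t / sinh t - 1 < t * tanh (p * t)"
      using \<open>t > 0\<close> identric_mean_exp [of 1 t] power_exp_mean_ord_exp [of 1 p t] by simp
  qed
next
  assume p: "p \<ge> 1 / 3"
  show "\<forall>a b :: real. a > 0 \<longrightarrow> b > 0 \<longrightarrow> a \<noteq> b \<longrightarrow>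
    identric_mean a b < power_exp_mean_ord p a b"
  proof (intro allI impI)
    fix a b :: real
    assume "a > 0" "b > 0" "a \<noteq> b"
    then obtain g t where gt: "g > 0" "t \<noteq> 0" and ab: "a = g * exp t" "b = g * exp (-t)"
      by (rule exp_coordinates)
    show "identric_mean a b < power_exp_mean_ord p a b"
      unfolding ab identric_mean_exp [OF gt] power_exp_mean_ord_exp [OF gt(1)]
      using gt coth_less_tanh [OF p gt(2)] by simp
  qed
qed

end
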